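(* Let $P$ be a $k$-regular contractible polycell. Then the directed flip-accessibility graph $A_P$ induces a distributive lattice structure on the set of tilings of $P$, for the order $Q\le Q'$ if and only if $Q'$ can be obtained from $Q$ by a (possibly empty) sequence of flips.
   Context: Let $G$ be a simple directed graph (no loops, no multiple edges, and if $(v,v')$ is an edge then $(v',v)$ is not). Fix a set $\Theta$ of elementary directed circuits of $G$, called cells. A polycell $P$ is a set of cells of $\Theta$; its edges and vertices are those of its cells. $P$ is $k$-regular if every cell of $P$ is a circuit of length $k$. The boundary $\partial P$ is an arbitrarily distinguished set of edges of $P$; a vertex is on the boundary if it is an endpoint of an edge of $\partial P$. It is assumed that any set of cells of $P$ has at most one edge in common. For an edge $e$ of $P$ not in $\partial P$, the set of all cells of $P$ containing $e$ is a tile. A tiling of $P$ is a partition of the cells of $P$ into tiles; for a tile $t$ of a tiling $Q$ the unique edge common to the cells of $t$ is a tiling edge of $Q$. A flow on $P$ is a map from edges of $P$ to $\mathbb{Z}$. A travel from $s$ to $s'$ is a set of edges of $P$ forming, orientations forgotten, a path from $s$ to $s'$; it is closed if it forms a cycle. The flux is $F_T(C)=\sum_{e\in T^+}C(e)-\sum_{e\in T^-}C(e)$ with $T^+$ (resp. $T^-$) the edges traversed along (resp. against) their direction. For a cell $c$, $T_c$ is the closed travel around $c$. $C$ is a tension if $F_T(C)=0$ for all closed travels $T$ in $P$. $P$ has a balanced boundary if, for a flow $C$ with $C(e)=1$ on $\partial P$, $F_T(C)=0$ for every closed travel $T$ made of edges of $\partial P$. $P$ is contractible if it has a balanced boundary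 and a flow $C$ on $P$ is a tension iff $F_{T_c}(C)=0$ for all cells $c$ of $P$. For a tiling $Q$ of a $k$-regular $P$, $C_Q(e)=1-k$ if $e$ is a tiling edge of $Q$, $C_Q(e)=1$ otherwise. Fix a vertex $\nu$ on the boundary. The height function $\varphi_Q$ is the potential of $C_Q$: $\varphi_Q(\nu)=0$ and $\varphi_Q(y)-\varphi_Q(x)=F_T(C_Q)$ for any travel $T$ from $x$ to $y$. A vertex $x$ of $P$ not on the boundary is a maximal vertex of $Q$ if $\varphi_Q(x)>\varphi_Q(y)$ for every neighbour $y$ of $x$; then the function equal to $\varphi_Q$ except at $x$, where it equals $\varphi_Q(x)-k$, is the height function of a tiling $Q'$ (tiling edges as in $Q$ except that the outgoing edges of $x$ become tiling edges and its incoming edges cease to be), obtained from $Q$ by a flip around $x$. The directed flip-accessibility graph $A_P$ has the tilings of $P$ as vertices and an edge $(Q,Q')$ whenever $Q'$ is obtained from $Q$ by a flip.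
   Formalization: The polycell is assumed finite and connected with connected boundary (the claim fails for infinite polycells or disconnected boundaries, and heights are undefined if P is disconnected), and distinct non-boundary edges are assumed to give distinct tiles so that tiling edges are unique. *)

theory Defs
  imports "Graph_Theory.Graph_Theory" "HOL-Algebra.Lattice" "HOL-Library.Disjoint_Sets"
begin

definition simple_directed :: "'a pair_pre_digraph \<Rightarrow> bool" where
  "simple_directed G \<longleftrightarrow> pair_loopfree_digraph G \<and> (\<forall>u v. (u, v) \<in> parcs G \<longrightarrow> (v, u) \<notin> parcs G)"

text \<open>
  A circuit is identified with its set of arcs, which forgets only the choice of a starting point.
  Hence a polycell, being a set of cells, is a set of arc sets.
\<close>

definition elementary_circuits :: "'a pair_pre_digraph \<Rightarrow> ('a \<times> 'a) set set" where
  "elementary_circuits G = {c. \<exists>p. pre_digraph.cycle (with_proj G) p \<and> c = set p}"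

definition edges :: "('a \<times> 'a) set set \<Rightarrow> ('a \<times> 'a) set" where
  "edges P = \<Union>P"

definition vertices :: "('a \<times> 'a) set set \<Rightarrow> 'a set" where
  "vertices P = Field (edges P)"

definition k_regular :: "nat \<Rightarrow> ('a \<times> 'a) set set \<Rightarrow> bool" where
  "k_regular k P \<longleftrightarrow> (\<forall>c\<in>P. card c = k)"

definition edge_digraph :: "('a \<times> 'a) set \<Rightarrow> 'a pair_pre_digraph" where
  "edge_digraph F = \<lparr>pverts = Field F, parcs = F\<rparr>"

text \<open>
  A travel made of edges of \<open>F\<close> is recorded as the set of its edges, each written in the direction
  in which it is traversed: \<open>(u, v)\<close> belongs to \<open>T\<close> if \<open>T\<close> goes from \<open>u\<close> to \<open>v\<close>, whether the
  edge of \<open>F\<close> is \<open>(u, v)\<close> or \<open>(v, u)\<close>. The bound on the length in a closed travel excludes going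
  back and forth along one edge, which the library counts as a cycle of a symmetric digraph.
\<close>

definition travel :: "('a \<times> 'a) set \<Rightarrow> 'a \<Rightarrow> ('a \<times> 'a) set \<Rightarrow> 'a \<Rightarrow> bool" where
  "travel F s T s' \<longleftrightarrow>
     (\<exists>p. pre_digraph.apath (with_proj (mk_symmetric (with_proj (edge_digraph F)))) s p s' \<and> T = set p)"

definition closed_travel :: "('a \<times> 'a) set \<Rightarrow> ('a \<times> 'a) set \<Rightarrow> bool" where
  "closed_travel F T \<longleftrightarrow>
     (\<exists>p. pre_digraph.cycle (with_proj (mk_symmetric (with_proj (edge_digraph F)))) p
        \<and> 3 \<le> length p \<and> T = set p)"

text \<open>
  A cell \<open>c\<close> is itself the closed travel around \<open>c\<close>, all edges being traversed along their direction.
\<close>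

definition flux :: "('a \<times> 'a) set set \<Rightarrow> ('a \<times> 'a \<Rightarrow> int) \<Rightarrow> ('a \<times> 'a) set \<Rightarrow> int" where
  "flux P C T = (\<Sum>e \<in> {e \<in> edges P. e \<in> T}. C e) - (\<Sum>e \<in> {e \<in> edges P. prod.swap e \<in> T}. C e)"

definition tension :: "('a \<times> 'a) set set \<Rightarrow> ('a \<times> 'a \<Rightarrow> int) \<Rightarrow> bool" where
  "tension P C \<longleftrightarrow> (\<forall>T. closed_travel (edges P) T \<longrightarrow> flux P C T = 0)"

definition balanced_boundary :: "('a \<times> 'a) set set \<Rightarrow> ('a \<times> 'a) set \<Rightarrow> bool" where
  "balanced_boundary P B \<longleftrightarrow>
     (\<forall>C. (\<forall>e\<in>B. C e = 1) \<longrightarrow> (\<forall>T. closed_travel B T \<longrightarrow> flux P C T = 0))"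

definition contractible :: "('a \<times> 'a) set set \<Rightarrow> ('a \<times> 'a) set \<Rightarrow> bool" where
  "contractible P B \<longleftrightarrow>
     balanced_boundary P B \<and> (\<forall>C. tension P C \<longleftrightarrow> (\<forall>c\<in>P. flux P C c = 0))"

definition tile_of :: "('a \<times> 'a) set set \<Rightarrow> 'a \<times> 'a \<Rightarrow> ('a \<times> 'a) set set" where
  "tile_of P e = {c \<in> P. e \<in> c}"

definition tiles :: "('a \<times> 'a) set set \<Rightarrow> ('a \<times> 'a) set \<Rightarrow> ('a \<times> 'a) set set set" where
  "tiles P B = tile_of P ` (edges P - B)"

definition tilings :: "('a \<times> 'a) set set \<Rightarrow> ('a \<times> 'a) set \<Rightarrow> ('a \<times> 'a) set set set set" where
  "tilings P B = {Q. partition_on P Q \<and> Q \<subseteq> tiles P B}"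

text \<open>
  For a tile with at least two cells the edge \<open>e\<close> with \<open>t = tile_of P e\<close> is the unique edge common
  to the cells of the tile. A tile \<open>{c}\<close> has all edges of \<open>c\<close> in common; its tiling edge is the
  non-boundary edge that lies in no other cell, and the injectivity of \<open>tile_of P\<close> on the
  non-boundary edges makes that edge unique.
\<close>

definition tiling_edges ::
    "('a \<times> 'a) set set \<Rightarrow> ('a \<times> 'a) set \<Rightarrow> ('a \<times> 'a) set set set \<Rightarrow> ('a \<times> 'a) set" where
  "tiling_edges P B Q = {e \<in> edges P - B. tile_of P e \<in> Q}"

lemma inter_tile:
  assumes one: "\<forall>S. S \<subseteq> P \<longrightarrow> 2 \<le> card S \<longrightarrow> card (\<Inter>S) \<le> 1"
    and fin: "\<forall>c\<in>P. finite c"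
    and e: "2 \<le> card (tile_of P e)"
  shows "\<Inter>(tile_of P e) = {e}"
proof -
  have "tile_of P e \<noteq> {}"
    using e by auto
  then obtain c where c: "c \<in> tile_of P e"
    by blast
  then have "\<Inter>(tile_of P e) \<subseteq> c" and "finite c"
    using fin by (auto simp: tile_of_def)
  then have "finite (\<Inter>(tile_of P e))"
    by (rule finite_subset)
  moreover have "card (\<Inter>(tile_of P e)) \<le> card {e}"
    using one[THEN spec, of "tile_of P e"] e by (simp add: tile_of_def)
  moreover have "{e} \<subseteq> \<Inter>(tile_of P e)"
    by (simp add: tile_of_def)
  ultimately show ?thesis
    by (metis card_seteq)
qed

lemma inj_on_tile_of:
  assumes one: "\<forall>S. S \<subseteq> P \<longrightarrow> 2 \<le> card S \<longrightarrow> card (\<Inter>S) \<le> 1"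
    and fin: "\<forall>c\<in>P. finite c"
    and two: "\<And>e. e \<in> edges P - B \<Longrightarrow> 2 \<le> card (tile_of P e)"
  shows "inj_on (tile_of P) (edges P - B)"
proof (rule inj_onI)
  fix e e' assume "e \<in> edges P - B" "e' \<in> edges P - B" and eq: "tile_of P e = tile_of P e'"
  then have "2 \<le> card (tile_of P e)" "2 \<le> card (tile_of P e')"
    by (simp_all only: two)
  then have "\<Inter>(tile_of P e) = {e}" "\<Inter>(tile_of P e') = {e'}"
    by (simp_all only: inter_tile[OF one fin])
  then have "{e} = {e'}"
    by (simp only: eq)
  then show "e = e'"
    by (rule singleton_inject)
qed

definition tiling_flow ::
    "('a \<times> 'a) set set \<Rightarrow> ('a \<times> 'a) set \<Rightarrow> nat \<Rightarrow> ('a \<times> 'a) set set set \<Rightarrow> 'a \<times> 'a \<Rightarrow> int" where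
  "tiling_flow P B k Q e = (if e \<in> tiling_edges P B Q then 1 - int k else 1)"

text \<open>Outside the vertices of \<open>P\<close> the height function is set to \<open>0\<close>, so that it is a unique function.\<close>

definition height ::
    "('a \<times> 'a) set set \<Rightarrow> ('a \<times> 'a) set \<Rightarrow> nat \<Rightarrow> 'a \<Rightarrow> ('a \<times> 'a) set set set \<Rightarrow> 'a \<Rightarrow> int" where
  "height P B k \<nu> Q = (THE \<phi>. \<phi> \<nu> = 0
     \<and> (\<forall>x y T. travel (edges P) x T y \<longrightarrow> \<phi> y - \<phi> x = flux P (tiling_flow P B k Q) T)
     \<and> (\<forall>x. x \<notin> vertices P \<longrightarrow> \<phi> x = 0))"

definition neighbours :: "('a \<times> 'a) set set \<Rightarrow> 'a \<Rightarrow> 'a set" where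
  "neighbours P x = {y. (x, y) \<in> edges P \<or> (y, x) \<in> edges P}"

definition maximal_vertex ::
    "('a \<times> 'a) set set \<Rightarrow> ('a \<times> 'a) set \<Rightarrow> nat \<Rightarrow> 'a \<Rightarrow> ('a \<times> 'a) set set set \<Rightarrow> 'a \<Rightarrow> bool" where
  "maximal_vertex P B k \<nu> Q x \<longleftrightarrow>
     x \<in> vertices P - Field B \<and> (\<forall>y\<in>neighbours P x. height P B k \<nu> Q x > height P B k \<nu> Q y)"

definition flip ::
    "('a \<times> 'a) set set \<Rightarrow> ('a \<times> 'a) set \<Rightarrow> nat \<Rightarrow> 'a \<Rightarrow> ('a \<times> 'a) set set set
      \<Rightarrow> ('a \<times> 'a) set set set \<Rightarrow> bool" where
  "flip P B k \<nu> Q Q' \<longleftrightarrow> Q \<in> tilings P B \<and> Q' \<in> tilings P B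
     \<and> (\<exists>x. maximal_vertex P B k \<nu> Q x
          \<and> height P B k \<nu> Q' = (height P B k \<nu> Q)(x := height P B k \<nu> Q x - int k))"

definition flip_graph ::
    "('a \<times> 'a) set set \<Rightarrow> ('a \<times> 'a) set \<Rightarrow> nat \<Rightarrow> 'a \<Rightarrow> ('a \<times> 'a) set set set pair_pre_digraph" where
  "flip_graph P B k \<nu> = \<lparr>pverts = tilings P B, parcs = {(Q, Q'). flip P B k \<nu> Q Q'}\<rparr>"

definition reachability_order :: "'b pair_pre_digraph \<Rightarrow> 'b gorder" where
  "reachability_order A =
     \<lparr>carrier = pverts A, eq = (=), le = (\<lambda>Q Q'. Q \<rightarrow>\<^sup>*\<^bsub>with_proj A\<^esub> Q')\<rparr>"

definition distributive_lattice :: "('b, 'c) gorder_scheme \<Rightarrow> bool" where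
  "distributive_lattice L \<longleftrightarrow> lattice L
     \<and> (\<forall>x\<in>carrier L. \<forall>y\<in>carrier L. \<forall>z\<in>carrier L.
          x \<sqinter>\<^bsub>L\<^esub> (y \<squnion>\<^bsub>L\<^esub> z) = (x \<sqinter>\<^bsub>L\<^esub> y) \<squnion>\<^bsub>L\<^esub> (x \<sqinter>\<^bsub>L\<^esub> z))"

end

theory Submission
  imports Defs
begin

text \<open>
  A tiling is determined by its height function, and the height functions are exactly the integer
  functions on the vertices that vanish at \<open>\<nu>\<close>, change by \<open>1\<close> or \<open>1 - k\<close> along every edge and by
  \<open>1\<close> along boundary edges: a cell with \<open>j\<close> edges of change \<open>1 - k\<close> satisfies \<open>k * (1 - j) = 0\<close>, so it
  has exactly one such edge. Two height functions agree modulo \<open>k\<close>, hence along an edge they cannot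
  cross, and pointwise minima and maxima of height functions are height functions. If
  \<open>\<psi> \<le> \<phi>\<close> are distinct height functions, then \<open>\<phi>\<close> can be flipped at a highest vertex among those
  with \<open>\<psi> x < \<phi> x\<close>, and it stays above \<open>\<psi>\<close>. Hence accessibility by flips is the reversed pointwise
  order of height functions.
\<close>

section \<open>Distributive lattices from pointwise minima and maxima\<close>

lemma distributive_lattice_of_pointwise_order:
  fixes L :: "'b gorder" and f :: "'b \<Rightarrow> 'v \<Rightarrow> 'o::linorder"
  assumes eq: "eq L = (=)"
    and le: "\<And>x y. x \<in> carrier L \<Longrightarrow> y \<in> carrier L \<Longrightarrow> le L x y \<longleftrightarrow> f y \<le> f x"
    and inj: "inj_on f (carrier L)"
    and min: "\<And>x y. x \<in> carrier L \<Longrightarrow> y \<in> carrier L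
      \<Longrightarrow> (\<lambda>a. min (f x a) (f y a)) \<in> f ` carrier L"
    and max: "\<And>x y. x \<in> carrier L \<Longrightarrow> y \<in> carrier L
      \<Longrightarrow> (\<lambda>a. max (f x a) (f y a)) \<in> f ` carrier L"
  shows "distributive_lattice L"
proof -
  interpret partial_order L
    by unfold_locales (auto simp: eq le intro: inj_onD[OF inj])
  \<comment> \<open>Since \<open>f\<close> reverses the order, the images of upper bounds lie
    pointwise below both images; so joins are minima and meets are maxima.\<close>
  have lub: "least L s (Upper L {x, y})"
    if "x \<in> carrier L" "y \<in> carrier L" "s \<in> carrier L" "f s = (\<lambda>a. min (f x a) (f y a))" for x y s
    using that by (auto simp: least_def Upper_def le le_fun_def)
  have glb: "greatest L s (Lower L {x, y})"
    if "x \<in> carrier L" "y \<in> carrier L" "s \<in> carrier L" "f s = (\<lambda>a. max (f x a) (f y a))" for x y s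
    using that by (auto simp: greatest_def Lower_def le le_fun_def)
  interpret lattice L
  proof
    show "\<exists>s. least L s (Upper L {x, y})" if xy: "x \<in> carrier L" "y \<in> carrier L" for x y
    proof -
      obtain s where "s \<in> carrier L" "f s = (\<lambda>a. min (f x a) (f y a))"
        using min[OF xy] by (metis imageE)
      then show ?thesis
        using lub[OF xy] by blast
    qed
    show "\<exists>s. greatest L s (Lower L {x, y})" if xy: "x \<in> carrier L" "y \<in> carrier L" for x y
    proof -
      obtain s where "s \<in> carrier L" "f s = (\<lambda>a. max (f x a) (f y a))"
        using max[OF xy] by (metis imageE)
      then show ?thesis
        using glb[OF xy] by blast
    qed
  qed
  have f_join: "f (x \<squnion>\<^bsub>L\<^esub> y) = (\<lambda>a. min (f x a) (f y a))"
    if xy: "x \<in> carrier L" "y \<in> carrier L" for x y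
  proof -
    obtain s where s: "s \<in> carrier L" "f s = (\<lambda>a. min (f x a) (f y a))"
      using min[OF xy] by (metis imageE)
    have "x \<squnion>\<^bsub>L\<^esub> y = s"
      unfolding join_def sup_def using lub[OF xy s] by (blast intro: least_unique)
    then show ?thesis
      by (simp add: s)
  qed
  have f_meet: "f (x \<sqinter>\<^bsub>L\<^esub> y) = (\<lambda>a. max (f x a) (f y a))"
    if xy: "x \<in> carrier L" "y \<in> carrier L" for x y
  proof -
    obtain s where s: "s \<in> carrier L" "f s = (\<lambda>a. max (f x a) (f y a))"
      using max[OF xy] by (metis imageE)
    have "x \<sqinter>\<^bsub>L\<^esub> y = s"
      unfolding meet_def inf_def using glb[OF xy s] by (blast intro: greatest_unique)
    then show ?thesis
      by (simp add: s)
  qed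
  have "x \<sqinter>\<^bsub>L\<^esub> (y \<squnion>\<^bsub>L\<^esub> z) = (x \<sqinter>\<^bsub>L\<^esub> y) \<squnion>\<^bsub>L\<^esub> (x \<sqinter>\<^bsub>L\<^esub> z)"
    if "x \<in> carrier L" "y \<in> carrier L" "z \<in> carrier L" for x y z
    \<comment> \<open>By injectivity it suffices to compare images, where the law is the
      distributivity of max over min in a linear order.\<close>
    using that by (intro inj_onD[OF inj]) (auto simp: f_join f_meet max_min_distrib2)
  then show ?thesis
    using lattice_axioms by (simp add: distributive_lattice_def)
qed

section \<open>Walks, cycles and connectedness\<close>

lemma pcas_append: "pcas u (p @ q) v \<longleftrightarrow> (\<exists>w. pcas u p w \<and> pcas w q v)"
  by (induct p arbitrary: u) auto

lemma sum_list_pcas: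
  assumes "pcas u p v"
  shows "(\<Sum>(x, y)\<leftarrow>p. \<phi> y - \<phi> x) = (\<phi> v - \<phi> u :: 'b::ab_group_add)"
  using assms by (induct p arbitrary: u) auto

text \<open>A closed walk that visits a vertex twice splits there into two shorter closed walks.\<close>

lemma sum_list_closed_walk_eq_0:
  fixes w :: "'a \<times> 'a \<Rightarrow> 'b::comm_monoid_add"
  assumes cycle: "\<And>u p. pcas u p u \<Longrightarrow> set p \<subseteq> A \<Longrightarrow> distinct (map snd p) \<Longrightarrow> p \<noteq> []
      \<Longrightarrow> sum_list (map w p) = 0"
    and "pcas u p u" "set p \<subseteq> A"
  shows "sum_list (map w p) = 0"
  using assms(2,3)
proof (induct p arbitrary: u rule: length_induct)
  case (1 p)
  show ?case
  proof (cases "distinct (map snd p)")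
    case True
    then show ?thesis
      using cycle 1 by (cases "p = []") auto
  next
    case False
    then obtain a b c z where "map snd p = a @ [z] @ b @ [z] @ c"
      using not_distinct_decomp by blast
    then obtain p1 e p2 f p3 where p: "p = p1 @ [e] @ p2 @ [f] @ p3" and "snd e = z" "snd f = z"
      by (auto simp: map_eq_append_conv map_eq_Cons_conv Cons_eq_map_conv append_eq_map_conv)
    then have "pcas z (p2 @ [f]) z" "pcas u (p1 @ [e] @ p3) u"
      using 1(2) by (auto simp: pcas_append)
    then have "sum_list (map w (p2 @ [f])) = 0" "sum_list (map w (p1 @ [e] @ p3)) = 0"
      using 1(1,3) by (auto simp only: p set_append length_append list.size Un_subset_iff
          intro!: 1(1)[rule_format])
    moreover have "sum_list (map w p)
        = sum_list (map w (p1 @ [e] @ p3)) + sum_list (map w (p2 @ [f]))"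
      by (simp add: p ac_simps)
    ultimately show ?thesis
      by simp
  qed
qed

lemma pawalk_verts_conv: "pcas u p v \<Longrightarrow> pawalk_verts u p = u # map snd p"
  by (induct p arbitrary: u) auto

text \<open>The vertices visited after the start are the heads of the arcs, so a cycle takes the
  form \<open>distinct (map snd p)\<close> on which the splitting of closed walks relies.\<close>

lemma cycle_with_proj_iff:
  "pre_digraph.cycle (with_proj H) p \<longleftrightarrow>
     (\<exists>u\<in>pverts H. set p \<subseteq> parcs H \<and> pcas u p u \<and> distinct (map snd p) \<and> p \<noteq> [])"
  by (auto simp: pre_digraph.cycle_def pre_digraph.awalk_def cas_with_proj_eq
      awalk_verts_with_proj_eq pawalk_verts_conv)

lemma parcs_mk_symmetric_edge_digraph:
  "parcs (mk_symmetric (with_proj (edge_digraph F))) = F \<union> F\<inverse>"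
  by (auto simp: parcs_mk_symmetric edge_digraph_def)

lemma pverts_mk_symmetric_edge_digraph:
  "pverts (mk_symmetric (with_proj (edge_digraph F))) = Field F"
  by (simp add: edge_digraph_def)

text \<open>Connectedness in the library is strong connectedness of the symmetric closure, hence the
  walk may traverse edges of \<open>F\<close> backwards.\<close>

lemma connected_edge_digraph_walk:
  assumes "connected (with_proj (edge_digraph F))" "u \<in> Field F" "v \<in> Field F"
  obtains p where "pcas u p v" "set p \<subseteq> F \<union> F\<inverse>"
proof -
  interpret pair_wf_digraph "mk_symmetric (with_proj (edge_digraph F))"
    by unfold_locales (auto simp: parcs_mk_symmetric edge_digraph_def Field_def)
  have "u \<rightarrow>\<^sup>*\<^bsub>with_proj (mk_symmetric (with_proj (edge_digraph F)))\<^esub> v"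
    using assms by (simp add: Digraph_Component.connected_def strongly_connected_def
        edge_digraph_def)
  then obtain p where "awalk u p v"
    using reachable_awalk by blast
  then show ?thesis
    using that by (auto simp: awalk_def parcs_mk_symmetric_edge_digraph)
qed

text \<open>Applied with \<open>g\<close> the difference of two potentials, the difference of two
  heights on the boundary, and such a difference modulo \<open>k\<close>.\<close>

lemma connected_edge_digraph_const:
  assumes "connected (with_proj (edge_digraph F))" "u \<in> Field F" "v \<in> Field F"
    and const: "\<And>x y. (x, y) \<in> F \<Longrightarrow> g x = g y"
  shows "g u = g v"
proof -
  obtain p where "pcas u p v" "set p \<subseteq> F \<union> F\<inverse>"
    using connected_edge_digraph_walk assms(1-3) .
  then show ?thesis
  proof (induct p arbitrary: u)
    case (Cons e p)
    moreover have "g (fst e) = g (snd e)"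
      using Cons.prems(2) const[of "fst e" "snd e"] const[of "snd e" "fst e"] by auto
    ultimately show ?case by simp
  qed simp
qed

section \<open>Flux, tension and potentials on a polycell\<close>

locale polycell =
  fixes P :: "('a \<times> 'a) set set" and B :: "('a \<times> 'a) set" and k :: nat and \<nu> :: 'a
  assumes finite_P: "finite P"
    and B_subset: "B \<subseteq> edges P"
    and asym: "(x, y) \<in> edges P \<Longrightarrow> (y, x) \<notin> edges P"
    and cell_walk: "c \<in> P \<Longrightarrow> \<exists>u p. pcas u p u \<and> distinct p \<and> c = set p"
    and card_cell: "c \<in> P \<Longrightarrow> card c = k"
    and inj_tile_of: "inj_on (tile_of P) (edges P - B)"
    and connected_edges: "connected (with_proj (edge_digraph (edges P)))"
    and connected_boundary: "connected (with_proj (edge_digraph B))"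
    and \<nu>_boundary: "\<nu> \<in> Field B"
    and tensionI: "(\<And>c. c \<in> P \<Longrightarrow> flux P C c = 0) \<Longrightarrow> tension P C"
begin

text \<open>The antisymmetric extension of a flow to reversed edges, which makes the flux a plain
  sum over the traversed arcs.\<close>

definition signed :: "('a \<times> 'a \<Rightarrow> int) \<Rightarrow> 'a \<times> 'a \<Rightarrow> int" where
  "signed C e = (if e \<in> edges P then C e else - C (prod.swap e))"

text \<open>A condition on single edges, where \<open>height\<close> speaks of all travels. Fixing
  the values at \<nu> and outside the vertices makes a potential unique.\<close>

definition potential :: "('a \<times> 'a \<Rightarrow> int) \<Rightarrow> ('a \<Rightarrow> int) \<Rightarrow> bool" where
  "potential C \<phi> \<longleftrightarrow> \<phi> \<nu> = 0 \<and> (\<forall>(x, y)\<in>edges P. \<phi> y - \<phi> x = C (x, y))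
     \<and> (\<forall>x. x \<notin> vertices P \<longrightarrow> \<phi> x = 0)"

text \<open>An intrinsic description of the height functions, see \<open>image_height\<close>. Its
  conditions concern single edges, so closure under minima, maxima and flips can be checked edge by
  edge.\<close>

definition heights :: "('a \<Rightarrow> int) set" where
  "heights = {\<phi>. \<phi> \<nu> = 0 \<and> (\<forall>x. x \<notin> vertices P \<longrightarrow> \<phi> x = 0)
     \<and> (\<forall>(x, y)\<in>edges P. \<phi> y - \<phi> x = 1 \<or> (x, y) \<notin> B \<and> \<phi> y - \<phi> x = 1 - int k)}"

lemma finite_cell: "c \<in> P \<Longrightarrow> finite c"
  using cell_walk by fastforce

lemma finite_edges: "finite (edges P)"
  using finite_P finite_cell by (auto simp: edges_def)

lemma finite_vertices: "finite (vertices P)"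
  using finite_edges by (simp add: vertices_def finite_Field)

lemma edges_vertices: "(x, y) \<in> edges P \<Longrightarrow> x \<in> vertices P \<and> y \<in> vertices P"
  by (auto simp: vertices_def Field_def)

lemma \<nu>_vertex: "\<nu> \<in> vertices P"
  using \<nu>_boundary mono_Field[OF B_subset] by (auto simp: vertices_def)

text \<open>Some cell exists since \<nu> lies on an edge, and a cell of length one would be a loop.
  The bound makes \<open>1 - int k\<close> negative, so the sign of a height change along an edge
  determines its value.\<close>

lemma two_le_k: "2 \<le> k"
proof -
  obtain e where "e \<in> edges P"
    using \<nu>_vertex by (auto simp: vertices_def Field_def)
  then obtain c where c: "c \<in> P" "e \<in> c"
    by (auto simp: edges_def)
  obtain u p where p: "pcas u p u" "distinct p" "c = set p"
    using cell_walk[OF c(1)] by blast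
  have "length p \<noteq> 0"
    using c p by auto
  moreover have "length p \<noteq> 1"
  proof
    assume "length p = 1"
    then have "p = [(u, u)]"
      using p(1) by (auto simp: length_Suc_conv)
    then show False
      using asym[of u u] c(1) p(3) by (auto simp: edges_def)
  qed
  moreover have "k = length p"
    using card_cell c(1) p distinct_card by fastforce
  ultimately show ?thesis
    by linarith
qed

lemma flux_eq_sum_signed:
  assumes "T \<subseteq> edges P \<union> (edges P)\<inverse>"
  shows "flux P C T = (\<Sum>e\<in>T. signed C e)"
proof -
  have fin: "finite T"
    using assms finite_edges finite_subset by blast
  \<comment> \<open>Swapping matches the arcs of \<open>T\<close> outside \<open>edges P\<close>
    with the edges that \<open>T\<close> traverses backwards; by \<open>asym\<close> a reversed edge
    is never itself an edge.\<close>
  have "(\<Sum>e\<in>T - edges P. signed C e) = (\<Sum>e\<in>{e \<in> edges P. prod.swap e \<in> T}. - C e)"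
    using assms asym
    by (intro sum.reindex_bij_witness[of _ prod.swap prod.swap]) (auto simp: signed_def)
  moreover have "(\<Sum>e\<in>{e \<in> edges P. e \<in> T}. C e) = (\<Sum>e\<in>T \<inter> edges P. signed C e)"
    by (intro sum.cong) (auto simp: signed_def)
  ultimately show ?thesis
    using sum.Int_Diff[OF fin, of "signed C" "edges P"] by (simp add: flux_def sum_negf)
qed

lemma flux_eq_sum_list:
  assumes "set p \<subseteq> edges P \<union> (edges P)\<inverse>" "distinct p"
  shows "flux P C (set p) = sum_list (map (signed C) p)"
  using flux_eq_sum_signed assms by (simp add: sum_list_distinct_conv_sum_set)

lemma signed_potential:
  assumes "potential C \<phi>" "(x, y) \<in> edges P \<union> (edges P)\<inverse>"
  shows "signed C (x, y) = \<phi> y - \<phi> x"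
  using assms asym by (fastforce simp: potential_def signed_def)

text \<open>Each arc contributes the difference of \<phi> at its ends, and the sum telescopes.
  Distinctness lets the list stand for the set of arcs.\<close>

lemma flux_potential:
  assumes "potential C \<phi>" "pcas u p v" "set p \<subseteq> edges P \<union> (edges P)\<inverse>" "distinct p"
  shows "flux P C (set p) = \<phi> v - \<phi> u"
proof -
  have "signed C e = (case e of (x, y) \<Rightarrow> \<phi> y - \<phi> x)" if "e \<in> set p" for e
    using signed_potential[OF assms(1), of "fst e" "snd e"] assms(3) that
    by (auto simp: case_prod_beta)
  then have "sum_list (map (signed C) p) = (\<Sum>(x, y)\<leftarrow>p. \<phi> y - \<phi> x)"
    by (intro arg_cong[of _ _ sum_list] map_cong) auto
  also have "\<dots> = \<phi> v - \<phi> u"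
    by (rule sum_list_pcas[OF assms(2)])
  finally show ?thesis
    using flux_eq_sum_list[OF assms(3,4)] by simp
qed

lemma flux_cell_potential:
  assumes "potential C \<phi>" "c \<in> P"
  shows "flux P C c = 0"
proof -
  obtain u p where "pcas u p u" "distinct p" "c = set p"
    using cell_walk[OF assms(2)] by blast
  moreover have "c \<subseteq> edges P"
    using assms(2) by (auto simp: edges_def)
  ultimately show ?thesis
    using flux_potential[OF assms(1)] by fastforce
qed

lemma flux_cell:
  assumes "c \<in> P"
  shows "flux P C c = (\<Sum>e\<in>c. C e)"
proof -
  have "c \<subseteq> edges P"
    using assms by (auto simp: edges_def)
  then show ?thesis
    by (subst flux_eq_sum_signed) (auto simp: signed_def intro!: sum.cong)
qed

text \<open>The right-hand side is the predicate under \<open>THE\<close> in \<open>height\<close>,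
  so heights can be handled through single edges.\<close>

lemma potential_iff_travel:
  "potential C \<phi> \<longleftrightarrow> \<phi> \<nu> = 0
     \<and> (\<forall>x y T. travel (edges P) x T y \<longrightarrow> \<phi> y - \<phi> x = flux P C T)
     \<and> (\<forall>x. x \<notin> vertices P \<longrightarrow> \<phi> x = 0)"
proof -
  have "\<phi> y - \<phi> x = flux P C T" if pot: "potential C \<phi>" and travel: "travel (edges P) x T y" for x y T
  proof -
    obtain p where p: "pcas x p y" "set p \<subseteq> edges P \<union> (edges P)\<inverse>" "T = set p"
        "distinct (pawalk_verts x p)"
      using travel by (auto simp: travel_def pre_digraph.apath_def pre_digraph.awalk_def
          cas_with_proj_eq awalk_verts_with_proj_eq parcs_mk_symmetric_edge_digraph)
    then have "distinct p"
      by (auto simp: pawalk_verts_conv distinct_map)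
    then show ?thesis
      using flux_potential[OF pot] p by simp
  qed
  \<comment> \<open>Conversely, a single edge is a travel; \<open>asym\<close> separates its
    endpoints, as an \<open>apath\<close> demands.\<close>
  moreover have "travel (edges P) x {(x, y)} y" "flux P C {(x, y)} = C (x, y)"
    if xy: "(x, y) \<in> edges P" for x y
  proof -
    have "x \<noteq> y" "x \<in> Field (edges P)"
      using asym xy by (auto simp: Field_def)
    then show "travel (edges P) x {(x, y)} y"
      unfolding travel_def using xy
      by (intro exI[of _ "[(x, y)]"]) (simp add: pre_digraph.apath_def pre_digraph.awalk_def
          cas_with_proj_eq awalk_verts_with_proj_eq parcs_mk_symmetric_edge_digraph
          pverts_mk_symmetric_edge_digraph del: pverts_mk_symmetric)
    show "flux P C {(x, y)} = C (x, y)"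
      using xy by (simp add: flux_eq_sum_signed signed_def)
  qed
  ultimately show ?thesis
    unfolding potential_def by fastforce
qed

text \<open>The difference of two potentials is constant along edges, hence on the connected
  polycell, and it vanishes at \<nu>.\<close>

lemma potential_unique:
  assumes "potential C \<phi>" "potential C \<psi>"
  shows "\<phi> = \<psi>"
proof
  fix x
  show "\<phi> x = \<psi> x"
  proof (cases "x \<in> vertices P")
    case True
    have "\<phi> x - \<psi> x = \<phi> \<nu> - \<psi> \<nu>"
    proof (rule connected_edge_digraph_const[OF connected_edges])
      show "\<phi> x - \<psi> x = \<phi> y - \<psi> y" if "(x, y) \<in> edges P" for x y
        using assms that unfolding potential_def by fastforce
    qed (use True \<nu>_vertex in \<open>auto simp: vertices_def\<close>)
    then show ?thesis
      using assms by (simp add: potential_def)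
  qed (use assms in \<open>simp add: potential_def\<close>)
qed

lemma height_eqI:
  assumes "potential (tiling_flow P B k Q) \<phi>"
  shows "height P B k \<nu> Q = \<phi>"
  unfolding height_def potential_iff_travel[symmetric]
  using assms potential_unique by blast

text \<open>Splitting reduces the claim to cycles. Those of length at least three are closed
  travels, loops are excluded by \<open>asym\<close>, and going back and forth along one edge
  cancels because \<open>signed\<close> is antisymmetric.\<close>

lemma closed_walk_signed_eq_0:
  assumes tension: "tension P C"
    and "pcas u p u" "set p \<subseteq> edges P \<union> (edges P)\<inverse>"
  shows "sum_list (map (signed C) p) = 0"
proof (rule sum_list_closed_walk_eq_0[OF _ assms(2,3)])
  fix u p
  assume p: "pcas u p u" "set p \<subseteq> edges P \<union> (edges P)\<inverse>" "distinct (map snd p)" "p \<noteq> []"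
  have "u \<in> Field (edges P)"
    using p by (cases p) (auto simp: Field_def)
  then have cycle: "pre_digraph.cycle
      (with_proj (mk_symmetric (with_proj (edge_digraph (edges P))))) p"
    using p unfolding cycle_with_proj_iff parcs_mk_symmetric_edge_digraph
      pverts_mk_symmetric_edge_digraph by blast
  consider "3 \<le> length p" | "length p = 1" | "length p = 2"
    using p(4) by (metis One_nat_def Suc_leI length_greater_0_conv le_neq_implies_less
        numeral_2_eq_2 numeral_3_eq_3)
  then show "sum_list (map (signed C) p) = 0"
  proof cases
    case 1
    then have "closed_travel (edges P) (set p)"
      using cycle unfolding closed_travel_def by blast
    then have "flux P C (set p) = 0"
      using tension by (simp add: tension_def)
    then show ?thesis
      using flux_eq_sum_list p by (simp add: distinct_map)
  next
    case 2
    then have "p = [(u, u)]"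
      using p(1) by (auto simp: length_Suc_conv)
    then show ?thesis
      using asym[of u u] p(2) by auto
  next
    case 3
    then obtain v where "p = [(u, v), (v, u)]"
      using p(1) by (auto simp: numeral_2_eq_2 length_Suc_conv)
    then show ?thesis
      using asym[of u v] asym[of v u] p(2) by (auto simp: signed_def)
  qed
qed

text \<open>The flow is integrated along an arbitrarily chosen walk from \<nu>; vanishing on closed
  walks makes the values at the ends of an edge consistent.\<close>

lemma tension_imp_potential:
  assumes "tension P C"
  obtains \<phi> where "potential C \<phi>"
proof -
  let ?A = "edges P \<union> (edges P)\<inverse>"
  have walk: "\<exists>p. pcas u p v \<and> set p \<subseteq> ?A" if "u \<in> vertices P" "v \<in> vertices P" for u v
    using connected_edge_digraph_walk[OF connected_edges] that unfolding vertices_def by metis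
  define \<pi> where "\<pi> x = (SOME p. pcas \<nu> p x \<and> set p \<subseteq> ?A)" for x
  have \<pi>: "pcas \<nu> (\<pi> x) x" "set (\<pi> x) \<subseteq> ?A" if "x \<in> vertices P" for x
    using someI_ex[OF walk[OF \<nu>_vertex that]] unfolding \<pi>_def by auto
  define \<phi> where "\<phi> x = (if x \<in> vertices P then sum_list (map (signed C) (\<pi> x)) else 0)" for x
  note closed = closed_walk_signed_eq_0[OF assms]
  have "\<phi> y - \<phi> x = C (x, y)" if xy: "(x, y) \<in> edges P" for x y
  proof -
    have x: "x \<in> vertices P" and y: "y \<in> vertices P"
      using xy edges_vertices by auto
    obtain r where r: "pcas y r \<nu>" "set r \<subseteq> ?A"
      using walk[OF y \<nu>_vertex] by blast
    \<comment> \<open>Both closed walks through \<open>\<nu>\<close> return along \<open>r\<close>; their difference is the claim.\<close>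
    have "sum_list (map (signed C) (\<pi> x @ (x, y) # r)) = 0"
      by (rule closed[of \<nu>]) (use \<pi>[OF x] r xy in \<open>auto simp: pcas_append\<close>)
    moreover have "sum_list (map (signed C) (\<pi> y @ r)) = 0"
      by (rule closed[of \<nu>]) (use \<pi>[OF y] r in \<open>auto simp: pcas_append\<close>)
    ultimately show ?thesis
      using x y xy by (simp add: \<phi>_def signed_def)
  qed
  \<comment> \<open>The chosen walk from \<nu> to itself need not be empty, but it is
    closed.\<close>
  moreover have "\<phi> \<nu> = 0"
    using closed[OF \<pi>[OF \<nu>_vertex]] by (simp add: \<phi>_def)
  moreover have "\<phi> x = 0" if "x \<notin> vertices P" for x
    using that by (simp add: \<phi>_def)
  ultimately have "potential C \<phi>"
    unfolding potential_def by blast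
  then show ?thesis
    by (rule that)
qed

section \<open>Tilings and their height functions\<close>

lemma cell_tiling_edge:
  assumes Q: "Q \<in> tilings P B" and c: "c \<in> P"
  shows "\<exists>!e. e \<in> c \<and> e \<in> tiling_edges P B Q"
proof -
  have part: "partition_on P Q" and "Q \<subseteq> tiles P B"
    using Q by (auto simp: tilings_def)
  obtain t where t: "t \<in> Q" "c \<in> t"
    using part c by (auto simp: partition_on_def)
  then obtain e where e: "e \<in> edges P - B" "t = tile_of P e"
    using \<open>Q \<subseteq> tiles P B\<close> by (auto simp: tiles_def)
  show ?thesis
  proof (rule ex1I[of _ e])
    show "e \<in> c \<and> e \<in> tiling_edges P B Q"
      using e t by (auto simp: tile_of_def tiling_edges_def)
    fix e' assume e': "e' \<in> c \<and> e' \<in> tiling_edges P B Q"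
    then have "tile_of P e' \<in> Q" "c \<in> tile_of P e'"
      using c by (auto simp: tile_of_def tiling_edges_def)
    \<comment> \<open>Blocks of a partition that share \<open>c\<close> coincide;
      \<open>inj_tile_of\<close> then identifies their edges.\<close>
    then have "tile_of P e' = t"
      using part t unfolding partition_on_def disjoint_def by blast
    then show "e' = e"
      using inj_onD[OF inj_tile_of] e e' by (auto simp: tiling_edges_def)
  qed
qed

text \<open>Each of the \<open>k\<close> edges counts 1 and each tiling edge loses \<open>k\<close>.
  Leaving \<open>Q\<close> arbitrary allows the formula to be used also for proving that a candidate
  is a tiling.\<close>

lemma sum_tiling_flow_cell:
  assumes "c \<in> P"
  shows "(\<Sum>e\<in>c. tiling_flow P B k Q e) = int k * (1 - int (card (c \<inter> tiling_edges P B Q)))"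
proof -
  have "tiling_flow P B k Q e = 1 - (if e \<in> tiling_edges P B Q then int k else 0)" for e
    by (simp add: tiling_flow_def)
  then show ?thesis
    using card_cell[OF assms] finite_cell[OF assms]
    by (simp add: sum_subtractf sum.inter_restrict[symmetric] right_diff_distrib)
qed

text \<open>With one tiling edge per cell the flux around each cell vanishes; contractibility, in
  the form \<open>tensionI\<close>, turns this local condition into a tension, which has a
  potential.\<close>

lemma potential_height:
  assumes "Q \<in> tilings P B"
  shows "potential (tiling_flow P B k Q) (height P B k \<nu> Q)"
proof -
  have "flux P (tiling_flow P B k Q) c = 0" if c: "c \<in> P" for c
  proof -
    obtain e where "c \<inter> tiling_edges P B Q = {e}"
      using cell_tiling_edge[OF assms c] by blast
    then show ?thesis
      using c by (simp add: flux_cell sum_tiling_flow_cell)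
  qed
  then obtain \<phi> where "potential (tiling_flow P B k Q) \<phi>"
    using tensionI tension_imp_potential by metis
  then show ?thesis
    using height_eqI by simp
qed

lemma height_edge:
  assumes "Q \<in> tilings P B" "(x, y) \<in> edges P"
  shows "height P B k \<nu> Q y - height P B k \<nu> Q x = tiling_flow P B k Q (x, y)"
  using potential_height[OF assms(1)] assms(2) by (auto simp: potential_def)

lemma height_in_heights:
  assumes "Q \<in> tilings P B"
  shows "height P B k \<nu> Q \<in> heights"
proof -
  let ?h = "height P B k \<nu> Q"
  have "?h y - ?h x = 1 \<or> (x, y) \<notin> B \<and> ?h y - ?h x = 1 - int k" if "(x, y) \<in> edges P" for x y
    using height_edge[OF assms that] by (auto simp: tiling_flow_def tiling_edges_def)
  then show ?thesis
    using potential_height[OF assms] unfolding potential_def heights_def by blast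
qed

lemma tiling_eq_image:
  assumes "Q \<in> tilings P B"
  shows "Q = tile_of P ` tiling_edges P B Q"
  using assms by (auto simp: tilings_def tiles_def tiling_edges_def)

text \<open>Since \<open>1 - int k\<close> differs from 1, the height reveals the tiling edges, and
  these determine the tiling; \<open>inj_height\<close> follows.\<close>

lemma tiling_edges_height:
  assumes "Q \<in> tilings P B"
  shows "tiling_edges P B Q
    = {(x, y) \<in> edges P. height P B k \<nu> Q y - height P B k \<nu> Q x \<noteq> 1}"
proof -
  have "(x, y) \<in> tiling_edges P B Q \<longleftrightarrow> tiling_flow P B k Q (x, y) \<noteq> 1" for x y
    using two_le_k by (simp add: tiling_flow_def)
  moreover have "tiling_edges P B Q \<subseteq> edges P"
    by (auto simp: tiling_edges_def)
  ultimately show ?thesis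
    using height_edge[OF assms] by auto
qed

lemma inj_height: "inj_on (height P B k \<nu>) (tilings P B)"
proof (rule inj_onI)
  fix Q Q'
  assume Q: "Q \<in> tilings P B" "Q' \<in> tilings P B" "height P B k \<nu> Q = height P B k \<nu> Q'"
  then have "tiling_edges P B Q = tiling_edges P B Q'"
    by (simp add: tiling_edges_height)
  then show "Q = Q'"
    using tiling_eq_image[OF Q(1)] tiling_eq_image[OF Q(2)] by simp
qed

text \<open>The edges along which \<phi> does not rise by 1 serve as tiling edges. Telescoping
  around a cell forces exactly one of them into it, whence the tiles cover \<open>P\<close> and are
  disjoint.\<close>

lemma heights_imp_height_of_tiling:
  assumes \<phi>: "\<phi> \<in> heights"
  shows "\<phi> \<in> height P B k \<nu> ` tilings P B"
proof -
  define E where "E = {(x, y) \<in> edges P. \<phi> y - \<phi> x \<noteq> 1}"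
  define Q where "Q = tile_of P ` E"
  have E: "E \<subseteq> edges P - B"
    using \<phi> unfolding E_def heights_def by fastforce
  \<comment> \<open>By \<open>inj_tile_of\<close> no non-boundary edge outside \<open>E\<close> has
    its tile in \<open>Q\<close>.\<close>
  have tiling_edges: "tiling_edges P B Q = E"
    using E inj_on_image_mem_iff[OF inj_tile_of _ E] by (auto simp: tiling_edges_def Q_def)
  have potential: "potential (tiling_flow P B k Q) \<phi>"
    using \<phi> unfolding potential_def tiling_flow_def tiling_edges E_def heights_def by fastforce
  have one: "\<exists>e. c \<inter> E = {e}" if c: "c \<in> P" for c
  proof -
    have "int k * (1 - int (card (c \<inter> E))) = 0"
      using flux_cell_potential[OF potential c] sum_tiling_flow_cell[OF c, of Q]
      by (simp add: flux_cell c tiling_edges)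
    then have "card (c \<inter> E) = 1"
      using two_le_k by simp
    then show ?thesis
      by (rule card_1_singletonE) blast
  qed
  have "partition_on P Q"
  proof (rule partition_onI)
    show "\<Union>Q = P"
      using one unfolding Q_def tile_of_def by fastforce
    show "{} \<notin> Q"
      using E by (fastforce simp: Q_def tile_of_def edges_def)
    show "disjnt s t" if st: "s \<in> Q" "t \<in> Q" "s \<noteq> t" for s t
    proof -
      obtain e f where e: "e \<in> E" "s = tile_of P e" and f: "f \<in> E" "t = tile_of P f"
        using st by (auto simp: Q_def)
      have False if c: "c \<in> s" "c \<in> t" for c
      proof -
        have "c \<in> P" "e \<in> c \<inter> E" "f \<in> c \<inter> E"
          using c e f by (auto simp: tile_of_def)
        then show False
          using one e f st(3) by (metis singletonD)
      qed
      then show ?thesis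
        by (auto simp: disjnt_def)
    qed
  qed
  then have "Q \<in> tilings P B"
    using E by (auto simp: tilings_def tiles_def Q_def)
  then show ?thesis
    using height_eqI[OF potential] by blast
qed

lemma image_height: "height P B k \<nu> ` tilings P B = heights"
  using height_in_heights heights_imp_height_of_tiling by blast

section \<open>Comparison of height functions\<close>

lemma heights_edge:
  assumes "\<phi> \<in> heights" "(x, y) \<in> edges P"
  shows "\<phi> y - \<phi> x = 1 \<or> (x, y) \<notin> B \<and> \<phi> y - \<phi> x = 1 - int k"
  using assms by (auto simp: heights_def)

text \<open>All heights rise by 1 along boundary edges, and the boundary is connected. So two
  heights can differ only off the boundary.\<close>

lemma heights_eq_boundary:
  assumes "\<phi> \<in> heights" "\<psi> \<in> heights" "x \<in> Field B"
  shows "\<phi> x = \<psi> x"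
proof -
  have "\<phi> x - \<psi> x = \<phi> \<nu> - \<psi> \<nu>"
  proof (rule connected_edge_digraph_const[OF connected_boundary assms(3) \<nu>_boundary])
    show "\<phi> x - \<psi> x = \<phi> y - \<psi> y" if "(x, y) \<in> B" for x y
      using heights_edge[OF assms(1), of x y] heights_edge[OF assms(2), of x y] that B_subset by auto
  qed
  then show ?thesis
    using assms by (simp add: heights_def)
qed

text \<open>Both 1 and \<open>1 - int k\<close> are congruent to 1 modulo \<open>k\<close>, so the
  residue of the difference is the same at all vertices, and it is 0 at \<nu>.\<close>

lemma heights_diff_dvd:
  assumes "\<phi> \<in> heights" "\<psi> \<in> heights"
  shows "int k dvd \<phi> x - \<psi> x"
proof (cases "x \<in> vertices P")
  case True
  have "(\<phi> x - \<psi> x) mod int k = (\<phi> \<nu> - \<psi> \<nu>) mod int k"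
  proof (rule connected_edge_digraph_const[OF connected_edges])
    fix x y assume xy: "(x, y) \<in> edges P"
    have "(\<phi> y - \<phi> x) - (\<psi> y - \<psi> x) \<in> {0, int k, - int k}"
      using heights_edge[OF assms(1) xy] heights_edge[OF assms(2) xy] by auto
    then have "int k dvd (\<phi> y - \<phi> x) - (\<psi> y - \<psi> x)"
      by auto
    then have "int k dvd (\<phi> y - \<psi> y) - (\<phi> x - \<psi> x)"
      by (simp add: algebra_simps)
    then show "(\<phi> x - \<psi> x) mod int k = (\<phi> y - \<psi> y) mod int k"
      by (metis mod_eq_dvd_iff)
  qed (use True \<nu>_vertex in \<open>auto simp: vertices_def\<close>)
  then show ?thesis
    using assms by (auto simp: heights_def)
qed (use assms in \<open>auto simp: heights_def\<close>)

lemma heights_gap: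
  assumes "\<phi> \<in> heights" "\<psi> \<in> heights" "\<psi> x < \<phi> x"
  shows "\<psi> x + int k \<le> \<phi> x"
  using zdvd_imp_le[OF heights_diff_dvd[OF assms(1,2), of x]] assms(3) by simp

text \<open>A crossing along an edge would, by \<open>heights_gap\<close>, alter the difference of
  the two functions by at least \<open>2 * k\<close>, whereas their changes along an edge differ by
  at most \<open>k\<close>.\<close>

lemma heights_minmax_edge:
  assumes "\<phi> \<in> heights" "\<psi> \<in> heights" "(x, y) \<in> edges P"
  shows "(\<phi> x \<le> \<psi> x \<and> \<phi> y \<le> \<psi> y) \<or> (\<psi> x \<le> \<phi> x \<and> \<psi> y \<le> \<phi> y)"
proof (rule ccontr)
  have bounds: "1 - int k \<le> \<phi> y - \<phi> x" "\<phi> y - \<phi> x \<le> 1" "1 - int k \<le> \<psi> y - \<psi> x" "\<psi> y - \<psi> x \<le> 1"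
    using heights_edge[OF assms(1,3)] heights_edge[OF assms(2,3)] two_le_k by auto
  assume "\<not> ?thesis"
  then consider "\<psi> x < \<phi> x" "\<phi> y < \<psi> y" | "\<phi> x < \<psi> x" "\<psi> y < \<phi> y"
    by linarith
  then show False
  proof cases
    case 1
    then show False
      using heights_gap[OF assms(1,2) 1(1)] heights_gap[OF assms(2,1) 1(2)] bounds two_le_k by simp
  next
    case 2
    then show False
      using heights_gap[OF assms(2,1) 2(1)] heights_gap[OF assms(1,2) 2(2)] bounds two_le_k by simp
  qed
qed

lemma heights_min:
  assumes "\<phi> \<in> heights" "\<psi> \<in> heights"
  shows "(\<lambda>x. min (\<phi> x) (\<psi> x)) \<in> heights"
proof -
  \<comment> \<open>At both ends of an edge the minimum agrees with the same one of the two
    functions.\<close>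
  have "min (\<phi> y) (\<psi> y) - min (\<phi> x) (\<psi> x) = 1
      \<or> (x, y) \<notin> B \<and> min (\<phi> y) (\<psi> y) - min (\<phi> x) (\<psi> x) = 1 - int k" if "(x, y) \<in> edges P" for x y
    using heights_minmax_edge[OF assms that] heights_edge[OF assms(1) that]
      heights_edge[OF assms(2) that] by (auto simp: min_def)
  then show ?thesis
    using assms by (auto simp: heights_def)
qed

lemma heights_max:
  assumes "\<phi> \<in> heights" "\<psi> \<in> heights"
  shows "(\<lambda>x. max (\<phi> x) (\<psi> x)) \<in> heights"
proof -
  have "max (\<phi> y) (\<psi> y) - max (\<phi> x) (\<psi> x) = 1
      \<or> (x, y) \<notin> B \<and> max (\<phi> y) (\<psi> y) - max (\<phi> x) (\<psi> x) = 1 - int k" if "(x, y) \<in> edges P" for x y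
    using heights_minmax_edge[OF assms that] heights_edge[OF assms(1) that]
      heights_edge[OF assms(2) that] by (auto simp: max_def)
  then show ?thesis
    using assms by (auto simp: heights_def)
qed

section \<open>Flips and reachability\<close>

lemma exists_local_max:
  assumes \<phi>: "\<phi> \<in> heights" and \<psi>: "\<psi> \<in> heights" and "\<psi> \<le> \<phi>" "\<phi> \<noteq> \<psi>"
  obtains x where "x \<in> vertices P - Field B" "\<psi> x < \<phi> x" "\<forall>y\<in>neighbours P x. \<phi> y < \<phi> x"
proof -
  let ?D = "{x. \<psi> x < \<phi> x}"
  have "\<phi> z = \<psi> z" if "z \<notin> vertices P \<or> z \<in> Field B" for z
    using that heights_eq_boundary[OF \<phi> \<psi>] \<phi> \<psi> by (auto simp: heights_def)
  then have sub: "?D \<subseteq> vertices P - Field B"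
    by force
  obtain z where "\<phi> z \<noteq> \<psi> z"
    using \<open>\<phi> \<noteq> \<psi>\<close> by blast
  then have "z \<in> ?D"
    using \<open>\<psi> \<le> \<phi>\<close> by (simp add: le_fun_def order_less_le)
  then have "finite (\<phi> ` ?D)" "\<phi> ` ?D \<noteq> {}"
    using finite_subset[OF sub] finite_vertices by auto
  then obtain x where x: "x \<in> ?D" and "\<phi> x = Max (\<phi> ` ?D)"
    using Max_in by (metis (no_types, lifting) imageE)
  then have le: "\<phi> y \<le> \<phi> x" if "\<psi> y < \<phi> y" for y
    using Max_ge[OF \<open>finite (\<phi> ` ?D)\<close>] that by auto
  have "\<phi> y < \<phi> x" if "y \<in> neighbours P x" for y
  \<comment> \<open>If \<open>y\<close> is in \<open>?D\<close>, the choice of \<open>x\<close>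
    leaves only equal heights, impossible along an edge. Otherwise \<psi> and \<phi> agree at
    \<open>y\<close>, and \<psi> would rise from \<open>x\<close> to \<open>y\<close> by at least
    \<open>k\<close>; an edge, in either direction, allows at most \<open>k - 1\<close>.\<close>
  proof (rule ccontr)
    assume "\<not> \<phi> y < \<phi> x"
    moreover have "\<psi> y \<le> \<phi> y"
      using \<open>\<psi> \<le> \<phi>\<close> by (simp add: le_fun_def)
    moreover note le[of y] heights_gap[OF \<phi> \<psi>, of x] x two_le_k
    moreover consider "(x, y) \<in> edges P" | "(y, x) \<in> edges P"
      using \<open>y \<in> neighbours P x\<close> by (auto simp: neighbours_def)
    then have "\<phi> y - \<phi> x \<in> {1, 1 - int k} \<and> \<psi> y - \<psi> x \<in> {1, 1 - int k}
        \<or> \<phi> x - \<phi> y \<in> {1, 1 - int k} \<and> \<psi> x - \<psi> y \<in> {1, 1 - int k}"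
      by cases (use heights_edge[OF \<phi>] heights_edge[OF \<psi>] in blast)+
    ultimately show False
      by auto
  qed
  then show ?thesis
    using that sub x by blast
qed

text \<open>At a local maximum the incoming edges change by 1 and the outgoing ones by
  \<open>1 - int k\<close>; lowering \<open>x\<close> by \<open>k\<close> exchanges these values,
  and no edge at \<open>x\<close> is a boundary edge.\<close>

lemma flip_down_in_heights:
  assumes \<phi>: "\<phi> \<in> heights" and x: "x \<in> vertices P - Field B"
    and less: "\<forall>y\<in>neighbours P x. \<phi> y < \<phi> x"
  shows "\<phi>(x := \<phi> x - int k) \<in> heights"
proof -
  let ?\<phi> = "\<phi>(x := \<phi> x - int k)"
  have "?\<phi> b - ?\<phi> a = 1 \<or> (a, b) \<notin> B \<and> ?\<phi> b - ?\<phi> a = 1 - int k" if ab: "(a, b) \<in> edges P" for a b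
  proof -
    have "a \<noteq> b"
      using asym ab by blast
    moreover have "(a, b) \<notin> B" if "a = x \<or> b = x"
      using x that by (auto simp: Field_def)
    moreover have "\<phi> b < \<phi> a" if "a = x"
      using less ab that by (simp add: neighbours_def)
    moreover have "\<phi> a < \<phi> b" if "b = x"
      using less ab that by (simp add: neighbours_def)
    ultimately show ?thesis
      using heights_edge[OF \<phi> ab] two_le_k by (cases "a = x"; cases "b = x") auto
  qed
  moreover have "x \<noteq> \<nu>"
    using x \<nu>_boundary by auto
  then have "?\<phi> \<nu> = 0" "\<forall>z. z \<notin> vertices P \<longrightarrow> ?\<phi> z = 0"
    using \<phi> x by (auto simp: heights_def)
  ultimately show ?thesis
    unfolding heights_def by blast
qed

text \<open>Induction on the total distance of the two heights: a flip at the vertex given by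
  \<open>exists_local_max\<close> reduces it by \<open>k\<close>.\<close>

lemma height_reachable:
  assumes "Q \<in> tilings P B" "Q' \<in> tilings P B" "height P B k \<nu> Q' \<le> height P B k \<nu> Q"
  shows "Q \<rightarrow>\<^sup>*\<^bsub>with_proj (flip_graph P B k \<nu>)\<^esub> Q'"
  using assms
proof (induct "nat (\<Sum>x\<in>vertices P. height P B k \<nu> Q x - height P B k \<nu> Q' x)" arbitrary: Q
    rule: less_induct)
  case less
  let ?h = "height P B k \<nu>"
  interpret F: wf_digraph "with_proj (flip_graph P B k \<nu>)"
    by unfold_locales (auto simp: flip_graph_def flip_def)
  note heights = height_in_heights[OF less.prems(1)] height_in_heights[OF less.prems(2)]
  show ?case
  proof (cases "?h Q = ?h Q'")
    case True
    then have "Q = Q'"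
      using inj_onD[OF inj_height] less.prems by blast
    moreover have "Q \<in> verts (with_proj (flip_graph P B k \<nu>))"
      using less.prems by (simp add: flip_graph_def)
    ultimately show ?thesis
      using F.reachable_refl by blast
  next
    case False
    obtain x where x: "x \<in> vertices P - Field B" "?h Q' x < ?h Q x"
        "\<forall>y\<in>neighbours P x. ?h Q y < ?h Q x"
      using exists_local_max[OF heights less.prems(3) False] .
    obtain R where R: "R \<in> tilings P B" "?h R = (?h Q)(x := ?h Q x - int k)"
      using flip_down_in_heights[OF heights(1) x(1,3)] image_height by (metis imageE)
    \<comment> \<open>At \<open>x\<close> the gap is at least \<open>k\<close>, so the flip does not
      pass below the target.\<close>
    have le: "?h Q' \<le> ?h R"
      using heights_gap[OF heights x(2)] less.prems(3) by (auto simp: R(2) le_fun_def)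
    have "(\<Sum>z\<in>vertices P. ?h R z - ?h Q' z) < (\<Sum>z\<in>vertices P. ?h Q z - ?h Q' z)"
      using x(1) two_le_k
      by (intro sum_strict_mono_ex1[OF finite_vertices]) (auto simp: R(2) intro!: bexI[of _ x])
    \<comment> \<open>Lets the strict decrease survive the truncation by \<open>nat\<close>.\<close>
    moreover have "0 \<le> (\<Sum>z\<in>vertices P. ?h R z - ?h Q' z)"
      using le by (intro sum_nonneg) (simp add: le_fun_def)
    ultimately have "R \<rightarrow>\<^sup>*\<^bsub>with_proj (flip_graph P B k \<nu>)\<^esub> Q'"
      using less.hyps R(1) less.prems(2) le by simp
    moreover have "(Q, R) \<in> arcs_ends (with_proj (flip_graph P B k \<nu>))"
      using x R less.prems(1) by (auto simp: flip_graph_def flip_def maximal_vertex_def)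
    ultimately show ?thesis
      using F.adj_reachable_trans by blast
  qed
qed

lemma reachable_height:
  assumes "Q \<rightarrow>\<^sup>*\<^bsub>with_proj (flip_graph P B k \<nu>)\<^esub> Q'"
  shows "height P B k \<nu> Q' \<le> height P B k \<nu> Q"
proof -
  have "(Q, Q') \<in> {(Q, Q'). flip P B k \<nu> Q Q'}\<^sup>*"
    using reachable_rtranclI[OF assms] by (simp add: flip_graph_def)
  then show ?thesis
  proof induct
    case (step R R')
    then have "height P B k \<nu> R' \<le> height P B k \<nu> R"
      by (auto simp: flip_def le_fun_def)
    then show ?case
      using step by simp
  qed simp
qed

section \<open>The lattice of tilings\<close>

lemma distributive_lattice_flip: "distributive_lattice (reachability_order (flip_graph P B k \<nu>))"
proof (rule distributive_lattice_of_pointwise_order[of _ "height P B k \<nu>"])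
  let ?L = "reachability_order (flip_graph P B k \<nu>)"
  have carrier: "carrier ?L = tilings P B"
    by (simp add: reachability_order_def flip_graph_def)
  show "eq ?L = (=)"
    by (simp add: reachability_order_def)
  show "le ?L Q Q' \<longleftrightarrow> height P B k \<nu> Q' \<le> height P B k \<nu> Q"
    if "Q \<in> carrier ?L" "Q' \<in> carrier ?L" for Q Q'
    using that height_reachable reachable_height unfolding carrier
    by (auto simp: reachability_order_def)
  show "inj_on (height P B k \<nu>) (carrier ?L)"
    unfolding carrier by (rule inj_height)
  show "(\<lambda>a. min (height P B k \<nu> Q a) (height P B k \<nu> Q' a)) \<in> height P B k \<nu> ` carrier ?L"
    and "(\<lambda>a. max (height P B k \<nu> Q a) (height P B k \<nu> Q' a)) \<in> height P B k \<nu> ` carrier ?L"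
    if "Q \<in> carrier ?L" "Q' \<in> carrier ?L" for Q Q'
    using that height_in_heights heights_min heights_max unfolding carrier image_height by auto
qed

end

theorem theorem9:
  fixes G :: "'a pair_pre_digraph"
    and \<Theta> P :: "('a \<times> 'a) set set"
    and B :: "('a \<times> 'a) set"
    and k :: nat
    and \<nu> :: 'a
  assumes "simple_directed G"
    and "\<Theta> \<subseteq> elementary_circuits G"
    and "P \<subseteq> \<Theta>" and "finite P"
    and "B \<subseteq> edges P"
    and "\<And>S. S \<subseteq> P \<Longrightarrow> 2 \<le> card S \<Longrightarrow> card (\<Inter>S) \<le> 1"
    and "inj_on (tile_of P) (edges P - B)"
    and "connected (with_proj (edge_digraph (edges P)))"
    and "connected (with_proj (edge_digraph B))"
    and "\<nu> \<in> Field B"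
    and "k_regular k P"
    and "contractible P B"
  shows "distributive_lattice (reachability_order (flip_graph P B k \<nu>))"
proof -
  have cell: "\<exists>u p. pcas u p u \<and> distinct (map snd p) \<and> c = set p \<and> c \<subseteq> parcs G"
    if "c \<in> P" for c
    using that assms(2,3) by (fastforce simp: elementary_circuits_def cycle_with_proj_iff)
  have "edges P \<subseteq> parcs G"
    using cell by (fastforce simp: edges_def)
  then have asym: "(y, x) \<notin> edges P" if "(x, y) \<in> edges P" for x y
    using that assms(1) by (auto simp: simple_directed_def)
  interpret polycell P B k \<nu>
  proof
    show "\<exists>u p. pcas u p u \<and> distinct p \<and> c = set p" if "c \<in> P" for c
      \<comment> \<open>Arcs with distinct heads are distinct.\<close>
      using cell[OF that] by (auto simp: distinct_map)
    show "card c = k" if "c \<in> P" for c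
      using that assms(11) by (simp add: k_regular_def)
    show "tension P C" if "\<And>c. c \<in> P \<Longrightarrow> flux P C c = 0" for C
      using that assms(12) by (simp add: contractible_def)
  qed (use assms asym in auto)
  show ?thesis
    by (rule distributive_lattice_flip)
qed

end
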